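(* Let $\mathcal{S}$ be a trajectory set, let $S\in\mathcal{S}$ be arbitrary, let $\rho\le\tau$ be two stopping times on $\mathcal{S}$, and let $f\in Q$. Then $$\overline{\sigma}_{\rho}(\overline{\sigma}_{\tau}f)(S)=\overline{\sigma}_{\rho}\big[\mathbf{1}_{\{\tau=\infty\}}f+\mathbf{1}_{\{\tau<\infty\}}\overline{\sigma}_{\tau}f\big](S)\le\overline{\sigma}_{\rho}f(S),$$ and, consequently, $$\underline{\sigma}_{\rho}f(S)\le\underline{\sigma}_{\rho}\big[\mathbf{1}_{\{\tau=\infty\}}f+\mathbf{1}_{\{\tau<\infty\}}\underline{\sigma}_{\tau}f\big](S)=\underline{\sigma}_{\rho}(\underline{\sigma}_{\tau}f)(S).$$
   Context: Fix $s_0\in\mathbb{R}$. A trajectory set $\mathcal{S}$ is a set of real sequences $S=(S_i)_{i\ge 0}$ with $S_0=s_0$. For $S\in\mathcal{S}$ and an integer $j\ge 0$, the node $(S,j)$ stands for $\mathcal{S}_{(S,j)}=\{\tilde S\in\mathcal{S}:\tilde S_i=S_i,\ 0\le i\le j\}$; also $\mathcal{S}_{(S,\infty)}=\{S\}$. $\mathcal{H}_{(S,j)}$ is the set of sequences $H=(H_i)_{i\ge j}$ of functions $H_i:\mathcal{S}_{(S,j)}\to\mathbb{R}$ that are non-anticipative: $H_i(\tilde S)=H_i(\hat S)$ whenever $\tilde S_k=\hat S_k$ for $j\le k\le i$. For $V\in\mathbb{R}$, $H\in\mathcal{H}_{(S,j)}$, $n\ge j$, put $\Pi^{V,H}_{j,n}(\tilde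 S)=V+\sum_{i=j}^{n-1}H_i(\tilde S)(\tilde S_{i+1}-\tilde S_i)$ for $\tilde S\in\mathcal{S}_{(S,j)}$. $\mathcal{E}_{(S,j)}$ is the set of all such functions $\Pi^{V,H}_{j,n}$, and $\mathcal{E}^+_{(S,j)}$ the set of its non-negative elements. $Q$ is the set of all functions $\mathcal{S}\to[-\infty,\infty]$. Conventions: $0\cdot(\pm\infty)=0$, $\infty+(-\infty)=\infty$, $u-v=u+(-v)$, $\inf\emptyset=\infty$. For $f\in Q$ and a node $(S,j)$, $\overline{\sigma}_jf(S)=\inf\sum_{m\ge 0}V^m$, the infimum being over all choices of $f_0=\Pi^{V^0,H^0}_{j,n_0}\in\mathcal{E}_{(S,j)}$ and, for $m\ge1$, $f_m=\liminf_{n\to\infty}\Pi^{V^m,H^m}_{j,n}$ with $\Pi^{V^m,H^m}_{j,n}\in\mathcal{E}^+_{(S,j)}$ for all $n\ge j$, such that $f\le\sum_{m\ge0}f_m$ on $\mathcal{S}_{(S,j)}$. Put $\underline{\sigma}_jf=-\overline{\sigma}_j(-f)$ and $\overline{\sigma}_\infty f(S)=\underline{\sigma}_\infty f(S)=f(S)$. A stopping time is a function $\tau:\mathcal{S}\to\{0,1,2,\dots\}\cup\{\infty\}$ such that for all $S,S'\in\mathcal{S}$, if $S_k=S'_k$ for all $0\le k\le\tau(S)$ (all $k\geq 0$ if $\tau(S)=\infty$), then $\tau(S)=\tau(S')$. For a stopping time $\tau$, $\overline{\sigma}_\tau f(S)=\overline{\sigma}_{\tau(S)}f(S)$ and $\underline{\sigma}_\tau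 f(S)=\underline{\sigma}_{\tau(S)}f(S)$. *)

theory Defs
  imports "HOL-Library.Extended_Real" "HOL-Library.Indicator_Function"
begin

text \<open>
  Functions on a trajectory set or on a node are represented by total functions on
  \<^typ>\<open>nat \<Rightarrow> real\<close>; every condition below only inspects their values on the
  trajectory set or node in question. Similarly, only the entries \<open>H i\<close> with \<open>i \<ge> j\<close> of a
  strategy at a node at time \<open>j\<close> matter.

  The operations of \<^typ>\<open>ereal\<close> already follow the conventions
  \<open>0 * (\<plusminus>\<infinity>) = 0\<close>, \<open>\<infinity> + (-\<infinity>) = \<infinity>\<close>, \<open>u - v = u + (-v)\<close> and \<open>Inf {} = \<infinity>\<close>.
\<close>

definition trajectory_set :: "real \<Rightarrow> (nat \<Rightarrow> real) set \<Rightarrow> bool" where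
  "trajectory_set s0 \<S> \<longleftrightarrow> (\<forall>S\<in>\<S>. S 0 = s0)"

definition node :: "(nat \<Rightarrow> real) set \<Rightarrow> (nat \<Rightarrow> real) \<Rightarrow> nat \<Rightarrow> (nat \<Rightarrow> real) set" where
  "node \<S> S j = {T \<in> \<S>. \<forall>i\<le>j. T i = S i}"

definition strategies ::
  "(nat \<Rightarrow> real) set \<Rightarrow> (nat \<Rightarrow> real) \<Rightarrow> nat \<Rightarrow> (nat \<Rightarrow> (nat \<Rightarrow> real) \<Rightarrow> real) set" where
  "strategies \<S> S j =
     {H. \<forall>i\<ge>j. \<forall>T\<in>node \<S> S j. \<forall>T'\<in>node \<S> S j.
           (\<forall>k. j \<le> k \<and> k \<le> i \<longrightarrow> T k = T' k) \<longrightarrow> H i T = H i T'}"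

definition portfolio ::
  "real \<Rightarrow> (nat \<Rightarrow> (nat \<Rightarrow> real) \<Rightarrow> real) \<Rightarrow> nat \<Rightarrow> nat \<Rightarrow> (nat \<Rightarrow> real) \<Rightarrow> real" where
  "portfolio V H j n T = V + (\<Sum>i=j..<n. H i T * (T (Suc i) - T i))"

definition elementary ::
  "(nat \<Rightarrow> real) set \<Rightarrow> (nat \<Rightarrow> real) \<Rightarrow> nat \<Rightarrow> ((nat \<Rightarrow> real) \<Rightarrow> real) set" where
  "elementary \<S> S j = {portfolio V H j n | V H n. H \<in> strategies \<S> S j \<and> j \<le> n}"

definition elementary_nonneg ::
  "(nat \<Rightarrow> real) set \<Rightarrow> (nat \<Rightarrow> real) \<Rightarrow> nat \<Rightarrow> ((nat \<Rightarrow> real) \<Rightarrow> real) set" where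
  "elementary_nonneg \<S> S j = {g \<in> elementary \<S> S j. \<forall>T\<in>node \<S> S j. 0 \<le> g T}"

text \<open>
  The functions \<open>f\<^sub>m\<close> of a superhedge: \<open>f\<^sub>0\<close> is an elementary function with horizon \<open>n0\<close>, and
  each \<open>f\<^sub>m\<close> with \<open>m \<ge> 1\<close> is the lower limit of the portfolios generated by one strategy.
\<close>

definition hedge_payoff ::
  "(nat \<Rightarrow> real) \<Rightarrow> (nat \<Rightarrow> nat \<Rightarrow> (nat \<Rightarrow> real) \<Rightarrow> real) \<Rightarrow> nat \<Rightarrow> nat \<Rightarrow> nat
     \<Rightarrow> (nat \<Rightarrow> real) \<Rightarrow> ereal" where
  "hedge_payoff V H j n0 m T =
     (if m = 0 then ereal (portfolio (V 0) (H 0) j n0 T)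
      else liminf (\<lambda>n. ereal (portfolio (V m) (H m) j n T)))"

text \<open>
  Nonnegativity of the portfolios for \<open>m \<ge> 1\<close> makes all terms with \<open>m \<ge> 1\<close> of both series below
  nonnegative (take \<open>n = j\<close> for \<open>V m\<close>), while the terms with \<open>m = 0\<close> are finite. Hence both
  series converge in \<^typ>\<open>ereal\<close>, possibly to \<open>\<infinity>\<close>, and \<^const>\<open>suminf\<close> is their value.
\<close>

definition superhedge ::
  "(nat \<Rightarrow> real) set \<Rightarrow> (nat \<Rightarrow> real) \<Rightarrow> nat \<Rightarrow> ((nat \<Rightarrow> real) \<Rightarrow> ereal)
     \<Rightarrow> (nat \<Rightarrow> real) \<Rightarrow> (nat \<Rightarrow> nat \<Rightarrow> (nat \<Rightarrow> real) \<Rightarrow> real) \<Rightarrow> nat \<Rightarrow> bool" where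
  "superhedge \<S> S j f V H n0 \<longleftrightarrow>
     j \<le> n0 \<and>
     (\<forall>m. H m \<in> strategies \<S> S j) \<and>
     (\<forall>m\<ge>1. \<forall>n\<ge>j. portfolio (V m) (H m) j n \<in> elementary_nonneg \<S> S j) \<and>
     (\<forall>T\<in>node \<S> S j. f T \<le> (\<Sum>m. hedge_payoff V H j n0 m T))"

definition upper_sigma ::
  "(nat \<Rightarrow> real) set \<Rightarrow> enat \<Rightarrow> ((nat \<Rightarrow> real) \<Rightarrow> ereal) \<Rightarrow> (nat \<Rightarrow> real) \<Rightarrow> ereal" where
  "upper_sigma \<S> t f S =
     (case t of
        enat j \<Rightarrow> Inf {\<Sum>m. ereal (V m) | V H n0. superhedge \<S> S j f V H n0}
      | \<infinity> \<Rightarrow> f S)"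

definition lower_sigma ::
  "(nat \<Rightarrow> real) set \<Rightarrow> enat \<Rightarrow> ((nat \<Rightarrow> real) \<Rightarrow> ereal) \<Rightarrow> (nat \<Rightarrow> real) \<Rightarrow> ereal" where
  "lower_sigma \<S> t f S =
     (case t of
        enat j \<Rightarrow> - upper_sigma \<S> (enat j) (\<lambda>T. - f T) S
      | \<infinity> \<Rightarrow> f S)"

definition stopping_time :: "(nat \<Rightarrow> real) set \<Rightarrow> ((nat \<Rightarrow> real) \<Rightarrow> enat) \<Rightarrow> bool" where
  "stopping_time \<S> \<tau> \<longleftrightarrow>
     (\<forall>S\<in>\<S>. \<forall>S'\<in>\<S>. (\<forall>k. enat k \<le> \<tau> S \<longrightarrow> S k = S' k) \<longrightarrow> \<tau> S = \<tau> S')"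

definition upper_sigma_at ::
  "(nat \<Rightarrow> real) set \<Rightarrow> ((nat \<Rightarrow> real) \<Rightarrow> enat) \<Rightarrow> ((nat \<Rightarrow> real) \<Rightarrow> ereal)
     \<Rightarrow> (nat \<Rightarrow> real) \<Rightarrow> ereal" where
  "upper_sigma_at \<S> \<tau> f S = upper_sigma \<S> (\<tau> S) f S"

definition lower_sigma_at ::
  "(nat \<Rightarrow> real) set \<Rightarrow> ((nat \<Rightarrow> real) \<Rightarrow> enat) \<Rightarrow> ((nat \<Rightarrow> real) \<Rightarrow> ereal)
     \<Rightarrow> (nat \<Rightarrow> real) \<Rightarrow> ereal" where
  "lower_sigma_at \<S> \<tau> f S = lower_sigma \<S> (\<tau> S) f S"

end

(*
  Stopping at tau every strategy of a superhedge of f at the node (S, j), j = rho S, keeps the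
  costs V^m. At a trajectory T with k = tau T finite, the stopped portfolios take the values
  Pi_(j,k)(T), and these are the initial values of a superhedge of f at (T, k) that continues the
  original strategies. Hence the stopped strategies superhedge the conditional upper functional of f
  at tau.
*)

theory Submission imports Defs begin

section \<open>Passage from a node to a later node\<close>

lemma node_mono:
  assumes "T \<in> node \<S> S j" "j \<le> k"
  shows "node \<S> T k \<subseteq> node \<S> S j"
  using assms by (auto simp: node_def)

lemma strategies_eq:
  assumes "H \<in> strategies \<S> S j" "T \<in> node \<S> S j" "T' \<in> node \<S> S j" "j \<le> i"
    and "\<And>k. j \<le> k \<Longrightarrow> k \<le> i \<Longrightarrow> T k = T' k"
  shows "H i T = H i T'"
  using assms unfolding strategies_def by blast

text \<open>Trajectories in \<open>node \<S> T k\<close> agree with \<open>T\<close> up to time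
  \<open>k\<close>, so agreement on [k, i] is already the agreement on [j, i] that
  non-anticipativity at time \<open>j\<close> asks for.\<close>

lemma strategies_mono:
  assumes H: "H \<in> strategies \<S> S j" and T: "T \<in> node \<S> S j" and jk: "j \<le> k"
  shows "H \<in> strategies \<S> T k"
proof -
  have "H i A = H i B"
    if "k \<le> i" "A \<in> node \<S> T k" "B \<in> node \<S> T k" "\<forall>l. k \<le> l \<and> l \<le> i \<longrightarrow> A l = B l" for i A B
  proof (rule strategies_eq[OF H])
    show "A \<in> node \<S> S j" "B \<in> node \<S> S j" using that node_mono[OF T jk] by auto
    show "j \<le> i" using that jk by simp
    show "A l = B l" if "j \<le> l" "l \<le> i" for l
      using \<open>A \<in> node \<S> T k\<close> \<open>B \<in> node \<S> T k\<close> that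
        \<open>\<forall>l. k \<le> l \<and> l \<le> i \<longrightarrow> A l = B l\<close>
      by (cases "k \<le> l") (auto simp: node_def)
  qed
  then show ?thesis unfolding strategies_def by blast
qed

lemma portfolio_split:
  assumes "j \<le> k" "k \<le> n"
  shows "portfolio (portfolio V H j k T) H k n T = portfolio V H j n T"
  using assms by (simp add: portfolio_def add.assoc sum.atLeastLessThan_concat)

text \<open>The gains up to \<open>n \<le> k\<close> involve only prices up to \<open>k\<close> and
  positions chosen before \<open>k\<close>, and these are constant on the later node. Hence the
  value at \<open>T\<close> can serve as an initial capital, a real number, for the whole
  node.\<close>

lemma portfolio_cong_node:
  assumes H: "H \<in> strategies \<S> S j" and T: "T \<in> node \<S> S j" and A: "A \<in> node \<S> T k"
    and jk: "j \<le> k" and n: "n \<le> k"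
  shows "portfolio V H j n A = portfolio V H j n T"
proof -
  have AT: "A l = T l" if "l \<le> k" for l using A that by (simp add: node_def)
  have "A \<in> node \<S> S j" using A node_mono[OF T jk] by auto
  then have "H i A = H i T" if "i \<in> {j..<n}" for i
    using that n by (intro strategies_eq[OF H _ T]) (auto simp: AT)
  then show ?thesis
    using n by (simp add: portfolio_def AT)
qed

section \<open>Stopping and restarting hedges\<close>

definition stopped ::
  "((nat \<Rightarrow> real) \<Rightarrow> enat) \<Rightarrow> (nat \<Rightarrow> (nat \<Rightarrow> real) \<Rightarrow> real) \<Rightarrow> nat \<Rightarrow> (nat \<Rightarrow> real) \<Rightarrow> real" where
  "stopped \<tau> H i T = (if enat i < \<tau> T then H i T else 0)"

text \<open>Whether \<open>\<tau>\<close> exceeds \<open>i\<close> is decided by the path up to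
  \<open>i\<close>, so cutting off positions at \<open>\<tau>\<close> does not look ahead.\<close>

lemma stopped_strategies:
  assumes \<tau>: "stopping_time \<S> \<tau>" and H: "H \<in> strategies \<S> S j"
  shows "stopped \<tau> H \<in> strategies \<S> S j"
proof -
  have "stopped \<tau> H i A = stopped \<tau> H i B"
    if "j \<le> i" and A: "A \<in> node \<S> S j" and B: "B \<in> node \<S> S j"
      and eq: "\<forall>l. j \<le> l \<and> l \<le> i \<longrightarrow> A l = B l" for i A B
  proof -
    \<comment> \<open>Non-anticipativity gives agreement only from \<open>j\<close> on, while
      stopping times see the whole past; membership in a common node supplies the times before
      \<open>j\<close>.\<close>
    have AB: "A l = B l" if "l \<le> i" for l
      using A B eq that by (cases "j \<le> l") (auto simp: node_def)
    have "A \<in> \<S>" "B \<in> \<S>" using A B by (auto simp: node_def)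
    have stop: "\<tau> C = \<tau> D" if "C \<in> \<S>" "D \<in> \<S>" "\<tau> C \<le> enat i" "\<And>l. l \<le> i \<Longrightarrow> C l = D l" for C D
    proof -
      have "\<forall>k. enat k \<le> \<tau> C \<longrightarrow> C k = D k"
        using that(3,4) order_trans by (metis enat_ord_simps(1))
      then show ?thesis using \<tau> that(1,2) unfolding stopping_time_def by blast
    qed
    have "enat i < \<tau> A \<longleftrightarrow> enat i < \<tau> B"
      using stop[of A B] stop[of B A] \<open>A \<in> \<S>\<close> \<open>B \<in> \<S>\<close> AB by (metis linorder_not_less)
    moreover have "H i A = H i B"
      using strategies_eq[OF H A B \<open>j \<le> i\<close>] eq by blast
    ultimately show ?thesis by (simp add: stopped_def)
  qed
  then show ?thesis unfolding strategies_def by blast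
qed

text \<open>The position at \<open>i\<close> earns the increment from \<open>i\<close> to
  \<open>Suc i\<close>, so the strict inequality in \<open>stopped\<close> keeps exactly the
  increments up to time \<open>k\<close>.\<close>

lemma portfolio_stopped_finite:
  assumes "\<tau> T = enat k"
  shows "portfolio V (stopped \<tau> H) j n T = portfolio V H j (min n k) T"
proof -
  have "(\<Sum>i=j..<n. stopped \<tau> H i T * (T (Suc i) - T i))
      = (\<Sum>i=j..<min n k. H i T * (T (Suc i) - T i))"
    using assms by (intro sum.mono_neutral_cong_right) (auto simp: stopped_def)
  then show ?thesis by (simp add: portfolio_def)
qed

lemma portfolio_stopped_infinite:
  assumes "\<tau> T = \<infinity>"
  shows "portfolio V (stopped \<tau> H) j n T = portfolio V H j n T"
  using assms by (simp add: portfolio_def stopped_def)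

lemma portfolio_elementary_nonneg_iff:
  assumes "H \<in> strategies \<S> S j" "j \<le> n"
  shows "portfolio V H j n \<in> elementary_nonneg \<S> S j \<longleftrightarrow>
    (\<forall>T\<in>node \<S> S j. 0 \<le> portfolio V H j n T)"
  using assms unfolding elementary_nonneg_def elementary_def by blast

text \<open>For positive \<open>m\<close> the stopped portfolio is constant in \<open>n\<close> from
  \<open>k\<close> on, so its lower limit is the value at \<open>k\<close>. The term with
  \<open>m = 0\<close> has the fixed horizon \<open>n0\<close>, whence the minimum.\<close>

lemma hedge_payoff_stopped_finite:
  assumes "\<tau> T = enat k"
  shows "hedge_payoff V (\<lambda>m. stopped \<tau> (H m)) j n0 m T
    = ereal (portfolio (V m) (H m) j (if m = 0 then min n0 k else k) T)"
proof -
  have "liminf (\<lambda>n. ereal (portfolio (V m) (H m) j (min n k) T))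
      = liminf (\<lambda>n. ereal (portfolio (V m) (H m) j k T))"
    by (intro Liminf_eq eventually_sequentiallyI[of k]) (simp add: min_absorb2)
  then show ?thesis
    using assms by (simp add: hedge_payoff_def portfolio_stopped_finite Liminf_const)
qed

lemma hedge_payoff_stopped_infinite:
  assumes "\<tau> T = \<infinity>"
  shows "hedge_payoff V (\<lambda>m. stopped \<tau> (H m)) j n0 m T = hedge_payoff V H j n0 m T"
  using assms by (simp add: hedge_payoff_def portfolio_stopped_infinite)

text \<open>The new capitals are the portfolio values at \<open>T\<close> at time \<open>k\<close>,
  and the same strategies go on from there, so all final payoffs on the later node are unchanged. If
  \<open>n0 < k\<close>, the elementary term is already settled at \<open>n0\<close>; the horizon
  \<open>max n0 k\<close> is then \<open>k\<close> itself, and no trade is added.\<close>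

lemma superhedge_restart:
  assumes hedge: "superhedge \<S> S j f V H n0" and T: "T \<in> node \<S> S j" and jk: "j \<le> k"
  shows "superhedge \<S> T k f
    (\<lambda>m. portfolio (V m) (H m) j (if m = 0 then min n0 k else k) T) H (max n0 k)"
    (is "superhedge _ _ _ _ ?V _ _")
proof -
  have n0: "j \<le> n0" and H: "H m \<in> strategies \<S> S j" for m
    using hedge by (auto simp: superhedge_def)
  have Hk: "H m \<in> strategies \<S> T k" for m
    by (rule strategies_mono[OF H T jk])
  have sub: "node \<S> T k \<subseteq> node \<S> S j" by (rule node_mono[OF T jk])
  have later: "portfolio (?V m) (H m) k n A = portfolio (V m) (H m) j n A"
    if "A \<in> node \<S> T k" "k \<le> n" "m \<noteq> 0" for m n A
  proof -
    have "?V m = portfolio (V m) (H m) j k A"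
      using that portfolio_cong_node[OF H T that(1) jk order_refl] by simp
    then show ?thesis using portfolio_split[OF jk \<open>k \<le> n\<close>] by simp
  qed
  have first: "portfolio (?V 0) (H 0) k (max n0 k) A = portfolio (V 0) (H 0) j n0 A"
    if A: "A \<in> node \<S> T k" for A
  proof (cases "k \<le> n0")
    case True
    then show ?thesis
      using portfolio_split[OF jk True, of "V 0" "H 0" A]
        portfolio_cong_node[OF H T A jk order_refl, of "V 0" 0, symmetric]
      by (simp add: min_absorb2 max_absorb1)
  next
    case False
    then have "portfolio (V 0) (H 0) j n0 A = portfolio (V 0) (H 0) j n0 T"
      by (intro portfolio_cong_node[OF H T A jk]) simp
    then show ?thesis
      using False by (simp add: portfolio_def[of _ _ k k] min_absorb1 max_absorb2)
  qed
  have payoff: "hedge_payoff ?V H k (max n0 k) m A = hedge_payoff V H j n0 m A"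
    if A: "A \<in> node \<S> T k" for m A
  proof (cases "m = 0")
    case True
    then show ?thesis using first[OF A] by (simp add: hedge_payoff_def)
  next
    case False
    \<comment> \<open>The two portfolios are known to coincide only for \<open>n \<ge> k\<close>,
      which suffices for a lower limit.\<close>
    have "liminf (\<lambda>n. ereal (portfolio (?V m) (H m) k n A))
        = liminf (\<lambda>n. ereal (portfolio (V m) (H m) j n A))"
      by (intro Liminf_eq eventually_sequentiallyI[of k] arg_cong[of _ _ ereal]
          later[OF A _ False])
    then show ?thesis using False by (simp add: hedge_payoff_def)
  qed
  have "portfolio (?V m) (H m) k n \<in> elementary_nonneg \<S> T k" if "1 \<le> m" "k \<le> n" for m n
  proof -
    have "portfolio (V m) (H m) j n \<in> elementary_nonneg \<S> S j"
      using hedge that jk by (simp add: superhedge_def)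
    then have "0 \<le> portfolio (V m) (H m) j n A" if "A \<in> node \<S> T k" for A
      using that sub by (auto simp: elementary_nonneg_def)
    then show ?thesis
      using that later[of _ n m] portfolio_elementary_nonneg_iff[OF Hk \<open>k \<le> n\<close>] by simp
  qed
  moreover have "f A \<le> (\<Sum>m. hedge_payoff ?V H k (max n0 k) m A)" if "A \<in> node \<S> T k" for A
    using hedge that sub payoff[OF that] by (auto simp: superhedge_def)
  ultimately show ?thesis
    using Hk by (simp add: superhedge_def)
qed

section \<open>Conditional functionals at stopping times\<close>

lemma upper_sigma_le:
  assumes "superhedge \<S> S j f V H n0"
  shows "upper_sigma \<S> (enat j) f S \<le> (\<Sum>m. ereal (V m))"
  using assms unfolding upper_sigma_def enat.case by (intro Inf_lower) blast

lemma upper_sigma_cong: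
  assumes "S \<in> \<S>" "\<And>T. T \<in> \<S> \<Longrightarrow> f T = g T"
  shows "upper_sigma \<S> t f S = upper_sigma \<S> t g S"
proof -
  have "superhedge \<S> S j f V H n0 = superhedge \<S> S j g V H n0" for j V H n0
    using assms by (simp add: superhedge_def node_def)
  then show ?thesis using assms by (simp add: upper_sigma_def split: enat.split)
qed

text \<open>Where \<open>\<tau>\<close> is finite, the payoffs of the stopped hedge are exactly the
  capitals of the restarted hedge, whose sum bounds the conditional functional. Where
  \<open>\<tau>\<close> is infinite, stopping changes nothing and that functional is
  \<open>f\<close>.\<close>

lemma superhedge_stopped:
  assumes \<tau>: "stopping_time \<S> \<tau>" and le: "\<And>T. T \<in> node \<S> S j \<Longrightarrow> enat j \<le> \<tau> T"
    and hedge: "superhedge \<S> S j f V H n0"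
  shows "superhedge \<S> S j (upper_sigma_at \<S> \<tau> f) V (\<lambda>m. stopped \<tau> (H m)) n0"
proof -
  have n0: "j \<le> n0" and H: "H m \<in> strategies \<S> S j" for m
    using hedge by (auto simp: superhedge_def)
  have H': "stopped \<tau> (H m) \<in> strategies \<S> S j" for m
    by (rule stopped_strategies[OF \<tau> H])
  have nonneg: "0 \<le> portfolio (V m) (H m) j n T"
    if "1 \<le> m" "j \<le> n" "T \<in> node \<S> S j" for m n T
    using hedge that by (simp add: superhedge_def elementary_nonneg_def)
  have "portfolio (V m) (stopped \<tau> (H m)) j n \<in> elementary_nonneg \<S> S j"
    if "1 \<le> m" "j \<le> n" for m n
  proof -
    have "0 \<le> portfolio (V m) (stopped \<tau> (H m)) j n T" if T: "T \<in> node \<S> S j" for T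
    proof (cases "\<tau> T")
      case (enat k)
      \<comment> \<open>Here \<open>j \<le> k\<close> keeps \<open>min n k\<close> at or above
        \<open>j\<close>, where nonnegativity of the original portfolios is available.\<close>
      then show ?thesis
        using le[OF T] nonneg[OF \<open>1 \<le> m\<close> _ T, of "min n k"] \<open>j \<le> n\<close>
        by (simp add: portfolio_stopped_finite)
    next
      case infinity
      then show ?thesis
        using nonneg[OF \<open>1 \<le> m\<close> \<open>j \<le> n\<close> T] by (simp add: portfolio_stopped_infinite)
    qed
    then show ?thesis
      using portfolio_elementary_nonneg_iff[OF H' \<open>j \<le> n\<close>] by simp
  qed
  moreover have "upper_sigma_at \<S> \<tau> f T
      \<le> (\<Sum>m. hedge_payoff V (\<lambda>m. stopped \<tau> (H m)) j n0 m T)" if T: "T \<in> node \<S> S j" for T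
  proof (cases "\<tau> T")
    case (enat k)
    then have "j \<le> k" using le[OF T] by simp
    from upper_sigma_le[OF superhedge_restart[OF hedge T this]] show ?thesis
      using enat by (simp add: upper_sigma_at_def hedge_payoff_stopped_finite)
  next
    case infinity
    then show ?thesis
      using hedge T
      by (simp add: upper_sigma_at_def upper_sigma_def superhedge_def
          hedge_payoff_stopped_infinite)
  qed
  ultimately show ?thesis
    using H' n0 by (simp add: superhedge_def)
qed

text \<open>A superhedge of \<open>f\<close> yields, at the same cost, one of the conditional
  functional at \<open>\<tau>\<close>; the infimum over all superhedges of \<open>f\<close> gives
  the inequality.\<close>

lemma upper_sigma_at_tower:
  assumes S: "S \<in> \<S>" and \<rho>: "stopping_time \<S> \<rho>" and \<tau>: "stopping_time \<S> \<tau>"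
    and le: "\<forall>T\<in>\<S>. \<rho> T \<le> \<tau> T"
  shows "upper_sigma_at \<S> \<rho> (upper_sigma_at \<S> \<tau> f) S \<le> upper_sigma_at \<S> \<rho> f S"
proof (cases "\<rho> S")
  case (enat j)
  \<comment> \<open>As a stopping time, \<open>\<rho>\<close> is constant equal to \<open>j\<close>
    on this node.\<close>
  have "enat j \<le> \<tau> T" if T: "T \<in> node \<S> S j" for T
  proof -
    have "T \<in> \<S>" and "\<forall>k. enat k \<le> \<rho> S \<longrightarrow> S k = T k"
      using T enat by (auto simp: node_def)
    then have "\<rho> S = \<rho> T" using \<rho> S unfolding stopping_time_def by blast
    then show ?thesis using le \<open>T \<in> \<S>\<close> enat by metis
  qed
  then have "upper_sigma \<S> (enat j) (upper_sigma_at \<S> \<tau> f) S \<le> (\<Sum>m. ereal (V m))"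
    if "superhedge \<S> S j f V H n0" for V H n0
    using upper_sigma_le[OF superhedge_stopped[OF \<tau> _ that]] by blast
  then show ?thesis
    unfolding upper_sigma_at_def[of \<S> \<rho>] enat
    by (subst (2) upper_sigma_def) (auto intro!: Inf_greatest)
next
  case infinity
  \<comment> \<open>With both times infinite at \<open>S\<close>, both sides reduce to
    \<open>f S\<close>.\<close>
  then have "\<tau> S = \<infinity>" using le S by (metis enat_ord_simps(5))
  then show ?thesis using infinity by (simp add: upper_sigma_at_def upper_sigma_def)
qed

lemma lower_sigma_at_eq:
  "lower_sigma_at \<S> \<tau> f T = - upper_sigma_at \<S> \<tau> (\<lambda>T. - f T) T"
  by (simp add: lower_sigma_at_def lower_sigma_def upper_sigma_at_def upper_sigma_def
      split: enat.split)

text \<open>On \<open>\<S>\<close> exactly one indicator is 1, and the other product is 0 even for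
  an infinite factor, so infinities of opposite sign never meet.\<close>

lemma stopping_indicator_split:
  fixes f g :: "'a \<Rightarrow> ereal" and \<tau> :: "'a \<Rightarrow> enat"
  assumes "T \<in> \<S>" "\<tau> T = \<infinity> \<Longrightarrow> g T = f T"
  shows "indicator {T \<in> \<S>. \<tau> T = \<infinity>} T * f T + indicator {T \<in> \<S>. \<tau> T < \<infinity>} T * g T = g T"
  using assms by (cases "\<tau> T = \<infinity>") (auto simp: indicator_def)

theorem theorem3p5:
  fixes s0 :: real
    and \<S> :: "(nat \<Rightarrow> real) set"
    and S :: "nat \<Rightarrow> real"
    and \<rho> \<tau> :: "(nat \<Rightarrow> real) \<Rightarrow> enat"
    and f :: "(nat \<Rightarrow> real) \<Rightarrow> ereal"
  assumes "trajectory_set s0 \<S>"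
    and "S \<in> \<S>"
    and "stopping_time \<S> \<rho>"
    and "stopping_time \<S> \<tau>"
    and "\<forall>T\<in>\<S>. \<rho> T \<le> \<tau> T"
  shows "upper_sigma_at \<S> \<rho> (upper_sigma_at \<S> \<tau> f) S =
           upper_sigma_at \<S> \<rho>
             (\<lambda>T. indicator {T \<in> \<S>. \<tau> T = \<infinity>} T * f T
                + indicator {T \<in> \<S>. \<tau> T < \<infinity>} T * upper_sigma_at \<S> \<tau> f T) S
       \<and> upper_sigma_at \<S> \<rho>
             (\<lambda>T. indicator {T \<in> \<S>. \<tau> T = \<infinity>} T * f T
                + indicator {T \<in> \<S>. \<tau> T < \<infinity>} T * upper_sigma_at \<S> \<tau> f T) S
           \<le> upper_sigma_at \<S> \<rho> f S
       \<and> lower_sigma_at \<S> \<rho> f S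
           \<le> lower_sigma_at \<S> \<rho>
               (\<lambda>T. indicator {T \<in> \<S>. \<tau> T = \<infinity>} T * f T
                  + indicator {T \<in> \<S>. \<tau> T < \<infinity>} T * lower_sigma_at \<S> \<tau> f T) S
       \<and> lower_sigma_at \<S> \<rho>
             (\<lambda>T. indicator {T \<in> \<S>. \<tau> T = \<infinity>} T * f T
                + indicator {T \<in> \<S>. \<tau> T < \<infinity>} T * lower_sigma_at \<S> \<tau> f T) S
           = lower_sigma_at \<S> \<rho> (lower_sigma_at \<S> \<tau> f) S"
proof -
  let ?u = "\<lambda>T. indicator {T \<in> \<S>. \<tau> T = \<infinity>} T * f T
    + indicator {T \<in> \<S>. \<tau> T < \<infinity>} T * upper_sigma_at \<S> \<tau> f T"
  let ?l = "\<lambda>T. indicator {T \<in> \<S>. \<tau> T = \<infinity>} T * f T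
    + indicator {T \<in> \<S>. \<tau> T < \<infinity>} T * lower_sigma_at \<S> \<tau> f T"
  note tower = upper_sigma_at_tower[OF assms(2-5)]
  have u: "?u T = upper_sigma_at \<S> \<tau> f T" if "T \<in> \<S>" for T
    using that by (intro stopping_indicator_split) (simp_all add: upper_sigma_at_def upper_sigma_def)
  have l: "?l T = lower_sigma_at \<S> \<tau> f T" if "T \<in> \<S>" for T
    using that by (intro stopping_indicator_split) (simp_all add: lower_sigma_at_def lower_sigma_def)
  have upper: "upper_sigma_at \<S> \<rho> ?u S = upper_sigma_at \<S> \<rho> (upper_sigma_at \<S> \<tau> f) S"
    unfolding upper_sigma_at_def[of \<S> \<rho>] by (rule upper_sigma_cong[OF assms(2) u])
  have lower: "lower_sigma_at \<S> \<rho> ?l S = lower_sigma_at \<S> \<rho> (lower_sigma_at \<S> \<tau> f) S"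
    unfolding lower_sigma_at_eq[of \<S> \<rho>] upper_sigma_at_def[of \<S> \<rho>]
    by (intro arg_cong[of _ _ uminus] upper_sigma_cong[OF assms(2)]) (simp only: l)
  \<comment> \<open>Duality: the upper inequality for the negative of \<open>f\<close>, with signs
    reversed; the two inner negations cancel.\<close>
  have "lower_sigma_at \<S> \<rho> f S \<le> lower_sigma_at \<S> \<rho> (lower_sigma_at \<S> \<tau> f) S"
    using tower[of "\<lambda>T. - f T"] by (simp add: lower_sigma_at_eq)
  then show ?thesis
    using tower[of f] unfolding upper lower by simp
qed

end
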